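(* Let $A,B\in\{0,1\}^{n\times n}$ and let $s,t\ge 1$ be integers such that $A$ is $(s,t)$-free. Then \[ C_+(B\otimes A)\;\ge\;\mathrm{rank}_+(B)\cdot\frac{|A|}{st}. \]
   Context: A boolean matrix $A$ is $(s,t)$-free if it does not contain an $(s+1)\times(t+1)$ all-ones submatrix. $|A|$ denotes the number of 1-entries of $A$. $\mathrm{rank}_+(B)$ is the minimum $r$ such that $B=PQ^\top$ over the non-negative integers with $P,Q$ being $n\times r$ matrices; equivalently, the minimum number of pairwise non-overlapping all-ones combinatorial rectangles covering all 1-entries of $B$. $\otimes$ is the Kronecker product ($B\otimes A$ is the block matrix with $(i,j)$ block $b_{ij}A$). A circuit is a directed acyclic graph whose in-degree-zero vertices are input gates and other vertices gates of unbounded fan-in with designated outputs; its size is its number of wires. A SUM-circuit computes a boolean matrix $M=(m_{ij})$ if, with each gate computing the integer sum of its children, output $i$ computes the formal linear form $\sum_j m_{ij}x_j$ over the non-negative integers. $C_+(M)$ is the minimum size of a SUM-circuit computing $M$. *)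

theory Defs
  imports Complex_Main "Jordan_Normal_Form.Matrix" "Graph_Theory.Pair_Digraph"
begin

section \<open>Boolean matrices\<close>

definition boolean_mat :: "nat mat \<Rightarrow> bool" where
  "boolean_mat A \<longleftrightarrow> (\<forall>i<dim_row A. \<forall>j<dim_col A. A $$ (i, j) \<in> {0, 1})"

definition num_ones :: "nat mat \<Rightarrow> nat" where
  "num_ones A = card {(i, j). i < dim_row A \<and> j < dim_col A \<and> A $$ (i, j) = 1}"

text \<open>Submatrices are taken on arbitrary, not necessarily contiguous, sets of rows and columns.\<close>

definition free_mat :: "nat \<Rightarrow> nat \<Rightarrow> nat mat \<Rightarrow> bool" where
  "free_mat s t A \<longleftrightarrow>
     \<not> (\<exists>I J. I \<subseteq> {..<dim_row A} \<and> J \<subseteq> {..<dim_col A} \<and> card I = s + 1 \<and> card J = t + 1 \<and>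
              (\<forall>i\<in>I. \<forall>j\<in>J. A $$ (i, j) = 1))"

definition kronecker :: "nat mat \<Rightarrow> nat mat \<Rightarrow> nat mat" (infixl \<open>\<otimes>\<^sub>K\<close> 70) where
  "B \<otimes>\<^sub>K A = mat (dim_row B * dim_row A) (dim_col B * dim_col A)
     (\<lambda>(i, j). B $$ (i div dim_row A, j div dim_col A) * A $$ (i mod dim_row A, j mod dim_col A))"

text \<open>The set in the following definition is nonempty, see \<open>nonneg_rank_witness\<close> below.\<close>

definition nonneg_rank :: "nat mat \<Rightarrow> nat" where
  "nonneg_rank B =
     (LEAST r. \<exists>P \<in> carrier_mat (dim_row B) r. \<exists>Q \<in> carrier_mat (dim_col B) r.
        B = P * transpose_mat Q)"

lemma nonneg_rank_witness:
  fixes B :: "nat mat"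
  shows "\<exists>r. \<exists>P \<in> carrier_mat (dim_row B) r. \<exists>Q \<in> carrier_mat (dim_col B) r.
           B = P * transpose_mat Q"
  by (rule exI[of _ "dim_col B"], rule bexI[of _ B], rule bexI[of _ "1\<^sub>m (dim_col B)"]) auto

section \<open>SUM-circuits\<close>

text \<open>
  A circuit with variables \<open>x\<^sub>0, \<dots>, x\<^sub>n\<^sub>-\<^sub>1\<close> and outputs numbered \<open>0, \<dots>, m - 1\<close>: the wires are the
  arcs, directed from a gate's children towards the gate, and \<open>inp j\<close> is the input gate of the
  variable \<open>x\<^sub>j\<close>.

  Outputs are designated among the vertices that are not input gates, and different outputs are
  different gates; an output gate may feed further gates.  So a copy of a variable costs a wire,
  and two equal rows are not served by one gate.  The value \<open>None\<close> means that the output has no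
  gate; it then denotes the empty sum, i.e. the zero form (see \<open>computes\<close>).  This is needed for
  zero rows, since every gate of such a circuit computes a nonzero form.
\<close>

locale sum_circuit = pair_fin_digraph G for G :: "'v pair_pre_digraph" +
  fixes n m :: nat and inp :: "nat \<Rightarrow> 'v" and outp :: "nat \<Rightarrow> 'v option"
  assumes acyclic: "acyclic (parcs G)"
    and inputs: "bij_betw inp {..<n} {v \<in> pverts G. in_degree G v = 0}"
    and outputs: "\<And>i v. i < m \<Longrightarrow> outp i = Some v \<Longrightarrow> v \<in> pverts G \<and> in_degree G v \<noteq> 0"
    and outputs_distinct:
      "\<And>i i' v. i < m \<Longrightarrow> i' < m \<Longrightarrow> outp i = Some v \<Longrightarrow> outp i' = Some v \<Longrightarrow> i = i'"

text \<open>
  \<open>F v j\<close> is the coefficient of \<open>x\<^sub>j\<close> in the formal linear form computed at \<open>v\<close>.  On the vertices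
  and for \<open>j < n\<close>, acyclicity makes these coefficients unique, so \<open>gate_forms\<close> describes the
  evaluation of the circuit.
\<close>

definition gate_forms ::
    "'v pair_pre_digraph \<Rightarrow> nat \<Rightarrow> (nat \<Rightarrow> 'v) \<Rightarrow> ('v \<Rightarrow> nat \<Rightarrow> nat) \<Rightarrow> bool" where
  "gate_forms G n inp F \<longleftrightarrow>
     (\<forall>k<n. \<forall>j<n. F (inp k) j = (if j = k then 1 else 0)) \<and>
     (\<forall>v\<in>pverts G. in_degree G v \<noteq> 0 \<longrightarrow> (\<forall>j<n. F v j = (\<Sum>u | (u, v) \<in> parcs G. F u j)))"

definition computes ::
    "'v pair_pre_digraph \<Rightarrow> (nat \<Rightarrow> 'v) \<Rightarrow> (nat \<Rightarrow> 'v option) \<Rightarrow> nat mat \<Rightarrow> bool" where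
  "computes G inp outp M \<longleftrightarrow>
     sum_circuit G (dim_col M) (dim_row M) inp outp \<and>
     (\<exists>F. gate_forms G (dim_col M) inp F \<and>
        (\<forall>i<dim_row M. \<forall>j<dim_col M.
           (case outp i of None \<Rightarrow> 0 | Some v \<Rightarrow> F v j) = M $$ (i, j)))"

text \<open>
  Every finite circuit is isomorphic to one whose vertices are natural numbers, so fixing the
  vertex type loses nothing.  For boolean \<open>M\<close> the minimum exists, see \<open>computes_witness\<close>.
\<close>

definition sum_complexity :: "nat mat \<Rightarrow> nat" where
  "sum_complexity M =
     (LEAST w. \<exists>(G :: nat pair_pre_digraph) inp outp. computes G inp outp M \<and> w = card (parcs G))"

lemma computes_witness:
  assumes "boolean_mat M"
  shows "\<exists>(G :: nat pair_pre_digraph) inp outp. computes G inp outp M"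
proof -
  define n where "n = dim_col M"
  define m where "m = dim_row M"
  define R where "R = {i. i < m \<and> (\<exists>j<n. M $$ (i, j) = 1)}"
  define G :: "nat pair_pre_digraph" where
    "G = \<lparr> pverts = {..<n} \<union> (\<lambda>i. n + i) ` R,
           parcs = {(j, n + i) | i j. i < m \<and> j < n \<and> M $$ (i, j) = 1} \<rparr>"
  define outp where "outp i = (if i \<in> R then Some (n + i) else None)" for i
  define F where "F v j = (if v < n then (if j = v then 1 else 0) else M $$ (v - n, j))" for v j
  have finR: "finite R" unfolding R_def by simp
  have "parcs G \<subseteq> {..<n} \<times> {..<n + m}" unfolding G_def by auto
  hence finA: "finite (parcs G)" by (rule finite_subset) simp
  have deg: "in_degree G v = 0 \<longleftrightarrow> (\<forall>u. (u, v) \<notin> parcs G)" for v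
  proof -
    have "finite (in_arcs G v)" using finA by (simp add: in_arcs_def)
    thus ?thesis by (auto simp: in_degree_def in_arcs_def)
  qed
  have deg_iff: "in_degree G v = 0 \<longleftrightarrow> v < n" if "v \<in> pverts G" for v
    using that unfolding deg by (auto simp: G_def R_def)
  have "acyclic (parcs G)"
    by (rule acyclicI_order[where f = "\<lambda>v :: nat. - int v"]) (auto simp: G_def)
  moreover have "pair_fin_digraph G"
    by unfold_locales (use finA finR in \<open>auto simp: G_def R_def\<close>)
  moreover have "bij_betw id {..<n} {v \<in> pverts G. in_degree G v = 0}"
  proof -
    have "{v \<in> pverts G. in_degree G v = 0} = {v \<in> pverts G. v < n}" using deg_iff by auto
    also have "\<dots> = {..<n}" by (auto simp: G_def)
    finally show ?thesis by simp
  qed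
  moreover have "v \<in> pverts G \<and> in_degree G v \<noteq> 0" if "i < m" "outp i = Some v" for i v
  proof -
    have v: "i \<in> R" "v = n + i" using that by (auto simp: outp_def split: if_splits)
    hence "v \<in> pverts G" by (auto simp: G_def)
    thus ?thesis using deg_iff[of v] v by simp
  qed
  moreover have "i = i'" if "outp i = Some v" "outp i' = Some v" for i i' v
    using that by (auto simp: outp_def split: if_splits)
  ultimately have circ: "sum_circuit G n m id outp"
    by (simp add: sum_circuit_def sum_circuit_axioms_def)
  have bool: "M $$ (i, j) = (if M $$ (i, j) = 1 then 1 else 0)" if "i < m" "j < n" for i j
    using assms that by (auto simp: boolean_mat_def n_def m_def)
  have "gate_forms G n id F"
  proof -
    have "F v j = (\<Sum>u | (u, v) \<in> parcs G. F u j)"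
      if v: "v \<in> pverts G" "in_degree G v \<noteq> 0" and j: "j < n" for v j
    proof -
      obtain i where i: "i \<in> R" "v = n + i"
        using v deg_iff[of v] by (auto simp: G_def)
      hence im: "i < m" by (simp add: R_def)
      have "(\<Sum>u | (u, v) \<in> parcs G. F u j)
              = (\<Sum>u\<in>{u. u < n \<and> M $$ (i, u) = 1}. if u = j then 1 else 0)"
        using im by (intro sum.cong) (auto simp: G_def i F_def)
      also have "\<dots> = (if M $$ (i, j) = 1 then 1 else 0)"
        using j by (simp add: sum.delta)
      finally show ?thesis using bool[OF im j] by (simp add: F_def i)
    qed
    thus ?thesis by (auto simp: gate_forms_def F_def)
  qed
  moreover have "(case outp i of None \<Rightarrow> 0 | Some v \<Rightarrow> F v j) = M $$ (i, j)"
    if "i < m" "j < n" for i j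
    using that bool[OF that] by (auto simp: outp_def F_def R_def split: if_splits)
  ultimately have "computes G id outp M"
    using circ unfolding computes_def n_def m_def by blast
  thus ?thesis by blast
qed

end

theory Submission
  imports Defs
begin

text \<open>
  Project the inputs and outputs of a circuit for \<open>B \<otimes> A\<close> to the columns and rows of \<open>A\<close>, and call
  a gate small if at most \<open>t\<close> projected inputs reach it.  Every path from an input to an output either
  leaves the set of small gates through exactly one wire, or stays in it and is charged to its last
  wire.  The entries charged to a wire form a combinatorial rectangle.  Its projection consists of
  1-entries of \<open>A\<close> and has at most \<open>st\<close> elements: a gate that is not small reaches at most \<open>s\<close> projected
  outputs because \<open>A\<close> is \<open>(s,t)\<close>-free.  On the other hand, for each 1-entry of \<open>A\<close> the wires whose
  rectangle lies over it factorise the copy of \<open>B\<close> at this entry, so there are at least \<open>rank\<^sub>+(B)\<close>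
  of them.  Double counting gives the bound.
\<close>

section \<open>Path counts\<close>

text \<open>For well-founded \<open>R\<close>, the number of directed paths from \<open>w\<close> to
  \<open>v\<close>, the empty path included, by recursion on the last arc.\<close>

definition num_paths :: "('v \<times> 'v) set \<Rightarrow> 'v \<Rightarrow> 'v \<Rightarrow> nat" where
  "num_paths R w = wfrec R (\<lambda>f v. of_bool (w = v) + (\<Sum>u | (u, v) \<in> R. f u))"

lemma num_paths_rec:
  assumes "wf R"
  shows "num_paths R w v = of_bool (w = v) + (\<Sum>u | (u, v) \<in> R. num_paths R w u)"
proof -
  have "num_paths R w v
      = of_bool (w = v) + (\<Sum>u | (u, v) \<in> R. cut (num_paths R w) R v u)"
    unfolding num_paths_def by (subst wfrec[OF assms]) simp
  also have "(\<Sum>u | (u, v) \<in> R. cut (num_paths R w) R v u) = (\<Sum>u | (u, v) \<in> R. num_paths R w u)"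
    by (intro sum.cong) (auto simp: cut_apply)
  finally show ?thesis .
qed

text \<open>A positive count means that some path exists, so whatever holds at \<open>w\<close> and
  passes along arcs reaches \<open>v\<close>.\<close>

lemma num_paths_induct [consumes 2, case_names refl step]:
  assumes "wf R" "num_paths R w v > 0"
    and refl: "P w"
    and step: "\<And>u v. (u, v) \<in> R \<Longrightarrow> P u \<Longrightarrow> P v"
  shows "P v"
  using assms(1,2)
proof (induction v rule: wf_induct_rule)
  case (less v)
  show ?case
  proof (cases "w = v")
    case True
    thus ?thesis using refl by simp
  next
    case False
    hence "(\<Sum>u | (u, v) \<in> R. num_paths R w u) \<noteq> 0"
      using less.prems num_paths_rec[OF assms(1), of w v] by simp
    then obtain u where "(u, v) \<in> R" "num_paths R w u > 0"
      by (metis (mono_tags, lifting) sum.neutral mem_Collect_eq neq0_conv)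
    thus ?thesis using less.IH step by blast
  qed
qed

lemma num_paths_into_closed:
  assumes "wf R" "\<And>u v. (u, v) \<in> R \<Longrightarrow> v \<in> S \<Longrightarrow> u \<in> S" "w \<notin> S" "v \<in> S"
  shows "num_paths R w v = 0"
proof (rule ccontr)
  assume "num_paths R w v \<noteq> 0"
  hence "num_paths R w v > 0" by simp
  with assms(1) have "v \<notin> S"
    by (induction rule: num_paths_induct) (use assms(2,3) in auto)
  thus False using assms(4) by simp
qed

text \<open>Unfolding \<open>f\<close> backwards from \<open>v\<close> stops at the first arc that
  comes out of \<open>S\<close>. Closedness leaves each backward path at most one such arc, and the
  sum sorts the paths by it.\<close>

lemma cut_decomposition:
  fixes f :: "'v \<Rightarrow> nat"
  assumes "finite R" "wf R"
    and closed: "\<And>u v. (u, v) \<in> R \<Longrightarrow> v \<in> S \<Longrightarrow> u \<in> S"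
    and f: "\<And>v. v \<notin> S \<Longrightarrow> f v = (\<Sum>u | (u, v) \<in> R. f u)"
    and "v \<notin> S"
  shows "f v = (\<Sum>(u, w) | (u, w) \<in> R \<and> u \<in> S \<and> w \<notin> S. f u * num_paths R w v)"
  using assms(2,5)
proof (induction v rule: wf_induct_rule)
  case (less v)
  let ?C = "{(u, w). (u, w) \<in> R \<and> u \<in> S \<and> w \<notin> S}"
  let ?N = "{u. (u, v) \<in> R}"
  have finC: "finite ?C" using assms(1) by (rule rev_finite_subset) auto
  have "?N \<subseteq> fst ` R" by force
  hence finN: "finite ?N" using assms(1) by (simp add: finite_subset)
  \<comment> \<open>The empty paths single out the cut arcs with head \<open>v\<close>, that is, the
    predecessors of \<open>v\<close> in \<open>S\<close>.\<close>
  have small: "(\<Sum>e\<in>?C. case e of (x, w) \<Rightarrow> f x * of_bool (w = v)) = (\<Sum>u | u \<in> ?N \<and> u \<in> S. f u)"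
  proof -
    have "(\<Sum>e\<in>?C. case e of (x, w) \<Rightarrow> f x * of_bool (w = v))
        = (\<Sum>e\<in>(\<lambda>u. (u, v)) ` {u \<in> ?N. u \<in> S}. case e of (x, w) \<Rightarrow> f x * of_bool (w = v))"
      using finC less.prems by (intro sum.mono_neutral_right) auto
    also have "\<dots> = (\<Sum>u | u \<in> ?N \<and> u \<in> S. f u)"
      by (subst sum.reindex) (auto simp: inj_on_def)
    finally show ?thesis .
  qed
  \<comment> \<open>No path re-enters \<open>S\<close>, which gives 0 for \<open>u\<close> in
    \<open>S\<close>; for the other \<open>u\<close> the induction hypothesis applies.\<close>
  have big: "(\<Sum>(x, w)\<in>?C. f x * num_paths R w u) = (if u \<in> S then 0 else f u)" if "u \<in> ?N" for u
    using that less.IH[of u] num_paths_into_closed[OF assms(2) closed, where v = u]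
    by (auto intro!: sum.neutral)
  have "(\<Sum>(x, w)\<in>?C. f x * num_paths R w v)
      = (\<Sum>e\<in>?C. case e of (x, w) \<Rightarrow> f x * of_bool (w = v))
        + (\<Sum>e\<in>?C. \<Sum>u\<in>?N. case e of (x, w) \<Rightarrow> f x * num_paths R w u)"
    unfolding sum.distrib[symmetric]
    by (intro sum.cong refl)
      (auto simp: num_paths_rec[OF assms(2), of _ v] distrib_left sum_distrib_left)
  also have "(\<Sum>e\<in>?C. \<Sum>u\<in>?N. case e of (x, w) \<Rightarrow> f x * num_paths R w u)
      = (\<Sum>u\<in>?N. if u \<in> S then 0 else f u)"
    by (subst sum.swap) (rule sum.cong[OF refl big])
  also have "(\<Sum>u\<in>?N. if u \<in> S then 0 else f u) = (\<Sum>u\<in>?N. if u \<notin> S then f u else 0)"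
    by (intro sum.cong) auto
  also have "\<dots> = (\<Sum>u | u \<in> ?N \<and> u \<notin> S. f u)"
    using finN by (simp only: sum.inter_filter)
  also note small
  also have "(\<Sum>u | u \<in> ?N \<and> u \<in> S. f u) + (\<Sum>u | u \<in> ?N \<and> u \<notin> S. f u) = (\<Sum>u\<in>?N. f u)"
    using finN by (subst sum.union_disjoint[symmetric]) (auto intro: sum.cong)
  finally show ?case using f[OF less.prems] by simp
qed

section \<open>Matrices\<close>

text \<open>Each \<open>e\<close> contributes a matrix of rank at most one, whose two vectors become
  a column of \<open>P\<close> and a column of \<open>Q\<close>.\<close>

lemma nonneg_rank_le_card:
  fixes B :: "nat mat"
  assumes "finite E"
    and B: "\<And>i j. i < dim_row B \<Longrightarrow> j < dim_col B \<Longrightarrow> B $$ (i, j) = (\<Sum>e\<in>E. p e i * q e j)"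
  shows "nonneg_rank B \<le> card E"
proof -
  obtain h where h: "bij_betw h {0..<card E} E"
    using ex_bij_betw_nat_finite[OF assms(1)] by blast
  define P where "P = mat (dim_row B) (card E) (\<lambda>(i, k). p (h k) i)"
  define Q where "Q = mat (dim_col B) (card E) (\<lambda>(j, k). q (h k) j)"
  have "B = P * transpose_mat Q"
  proof (rule eq_matI)
    fix i j assume "i < dim_row (P * transpose_mat Q)" "j < dim_col (P * transpose_mat Q)"
    hence ij: "i < dim_row B" "j < dim_col B" by (simp_all add: P_def Q_def)
    have "B $$ (i, j) = (\<Sum>k\<in>{0..<card E}. p (h k) i * q (h k) j)"
      unfolding B[OF ij] by (rule sum.reindex_bij_betw[OF h, symmetric])
    thus "B $$ (i, j) = (P * transpose_mat Q) $$ (i, j)"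
      using ij by (simp add: P_def Q_def scalar_prod_def)
  qed (simp_all add: P_def Q_def)
  moreover have "P \<in> carrier_mat (dim_row B) (card E)" "Q \<in> carrier_mat (dim_col B) (card E)"
    by (simp_all add: P_def Q_def)
  ultimately show ?thesis unfolding nonneg_rank_def by (intro Least_le) blast
qed

text \<open>Freeness speaks of the exact sizes \<open>s + 1\<close> and \<open>t + 1\<close>, so
  larger index sets are first shrunk.\<close>

lemma free_mat_card:
  assumes "free_mat s t A" "I \<subseteq> {..<dim_row A}" "J \<subseteq> {..<dim_col A}"
    and "\<And>i j. i \<in> I \<Longrightarrow> j \<in> J \<Longrightarrow> A $$ (i, j) = 1" "card J > t"
  shows "card I \<le> s"
proof (rule ccontr)
  assume "\<not> card I \<le> s"
  then obtain I' where I': "I' \<subseteq> I" "card I' = s + 1"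
    by (metis not_less_eq_eq obtain_subset_with_card_n Suc_eq_plus1)
  obtain J' where J': "J' \<subseteq> J" "card J' = t + 1"
    using assms(5) by (metis Suc_leI obtain_subset_with_card_n Suc_eq_plus1)
  have "I' \<subseteq> {..<dim_row A}" "J' \<subseteq> {..<dim_col A}" "\<forall>i\<in>I'. \<forall>j\<in>J'. A $$ (i, j) = 1"
    using I' J' assms(2-4) by blast+
  thus False using assms(1) I'(2) J'(2) unfolding free_mat_def by blast
qed

lemma kronecker_dim [simp]:
  "dim_row (B \<otimes>\<^sub>K A) = dim_row B * dim_row A" "dim_col (B \<otimes>\<^sub>K A) = dim_col B * dim_col A"
  by (simp_all add: kronecker_def)

lemma mod_less_of_less_mult: "i < k * l \<Longrightarrow> i mod l < (l :: nat)"
  by (cases "l = 0") auto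

lemma div_less_of_less_mult: "i < k * l \<Longrightarrow> i div l < (k :: nat)"
  by (simp add: less_mult_imp_div_less)

lemma block_index_less: "a < k \<Longrightarrow> b < l \<Longrightarrow> a * l + b < k * (l :: nat)"
proof -
  assume "a < k" "b < l"
  hence "a * l + b < Suc a * l" by simp
  also have "\<dots> \<le> k * l" using \<open>a < k\<close> by (intro mult_le_mono1) simp
  finally show ?thesis .
qed

text \<open>Used with \<open>(i, j)\<close> fixed and \<open>(a, b)\<close> varying: over a 1-entry
  of \<open>A\<close> this exhibits a copy of \<open>B\<close>.\<close>

lemma kronecker_block:
  assumes "a < dim_row B" "b < dim_col B" "i < dim_row A" "j < dim_col A"
  shows "(B \<otimes>\<^sub>K A) $$ (a * dim_row A + i, b * dim_col A + j) = B $$ (a, b) * A $$ (i, j)"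
  using assms by (simp add: kronecker_def block_index_less)

lemma kronecker_pos_imp_one:
  assumes "boolean_mat A" "i < dim_row B * dim_row A" "j < dim_col B * dim_col A"
    and "(B \<otimes>\<^sub>K A) $$ (i, j) > 0"
  shows "A $$ (i mod dim_row A, j mod dim_col A) = 1"
proof -
  have "A $$ (i mod dim_row A, j mod dim_col A) \<noteq> 0"
    using assms(2-4) by (auto simp: kronecker_def)
  moreover have "A $$ (i mod dim_row A, j mod dim_col A) \<in> {0, 1}"
    using assms(1) mod_less_of_less_mult[OF assms(2)] mod_less_of_less_mult[OF assms(3)]
    unfolding boolean_mat_def by blast
  ultimately show ?thesis by simp
qed

lemma boolean_mat_kronecker:
  assumes "boolean_mat A" "boolean_mat B"
  shows "boolean_mat (B \<otimes>\<^sub>K A)"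
  unfolding boolean_mat_def
proof (intro allI impI)
  fix i j assume "i < dim_row (B \<otimes>\<^sub>K A)" "j < dim_col (B \<otimes>\<^sub>K A)"
  hence ij: "i < dim_row B * dim_row A" "j < dim_col B * dim_col A" by simp_all
  have "B $$ (i div dim_row A, j div dim_col A) \<in> {0, 1}"
    using assms(2) ij by (simp add: boolean_mat_def div_less_of_less_mult)
  moreover have "A $$ (i mod dim_row A, j mod dim_col A) \<in> {0, 1}"
    using assms(1) mod_less_of_less_mult[OF ij(1)] mod_less_of_less_mult[OF ij(2)]
    unfolding boolean_mat_def by blast
  ultimately show "(B \<otimes>\<^sub>K A) $$ (i, j) \<in> {0, 1}"
    using ij by (auto simp: kronecker_def)
qed

section \<open>The number of wires\<close>

text \<open>Multiplied out by \<open>s * t\<close>, so that the double counting stays in the natural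
  numbers.\<close>

lemma wires_lower_bound:
  assumes comp: "computes G inp outp (B \<otimes>\<^sub>K A)"
    and "boolean_mat A" "free_mat s t A" "s \<ge> 1" "t \<ge> 1"
  shows "nonneg_rank B * num_ones A \<le> card (parcs G) * (s * t)"
proof -
  define m where "m = dim_row B * dim_row A"
  define n where "n = dim_col B * dim_col A"
  define R where "R = parcs G"
  obtain F where circ: "sum_circuit G n m inp outp" and forms: "gate_forms G n inp F"
    and M: "\<And>i j. i < m \<Longrightarrow> j < n \<Longrightarrow>
      (B \<otimes>\<^sub>K A) $$ (i, j) = (case outp i of None \<Rightarrow> 0 | Some v \<Rightarrow> F v j)"
    using comp unfolding computes_def m_def n_def by fastforce
  interpret sum_circuit G n m inp outp by (rule circ)
  have finR: "finite R" unfolding R_def by simp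
  have wfR: "wf R" using finR acyclic unfolding R_def by (rule finite_acyclic_wf)
  have deg: "in_degree G v \<noteq> 0" if "(u, v) \<in> R" for u v
  proof -
    \<comment> \<open>\<open>in_degree\<close> is a cardinality and would be 0 for an infinite set
      of arcs.\<close>
    have "finite (in_arcs G v)" using finR unfolding R_def by (simp add: in_arcs_def)
    thus ?thesis using that unfolding R_def by (auto simp: in_degree_def in_arcs_def)
  qed
  have F_rec: "F v j = (\<Sum>u | (u, v) \<in> R. F u j)"
    if "v \<in> pverts G" "in_degree G v \<noteq> 0" "j < n" for v j
    using forms that unfolding gate_forms_def R_def by blast
  have verts: "u \<in> pverts G" "v \<in> pverts G" if "(u, v) \<in> R" for u v
    using that in_arcsD1 in_arcsD2 unfolding R_def by auto
  \<comment> \<open>Nothing cancels over the natural numbers, so a variable that reaches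
    \<open>u\<close> also reaches \<open>v\<close>.\<close>
  have F_pos: "F v j > 0" if "(u, v) \<in> R" "j < n" "F u j > 0" for u v j
  proof -
    have "{x. (x, v) \<in> R} \<subseteq> fst ` R" by force
    hence "finite {x. (x, v) \<in> R}" using finR by (simp add: finite_subset)
    hence "F u j \<le> (\<Sum>x | (x, v) \<in> R. F x j)" using that by (intro member_le_sum) auto
    thus ?thesis using F_rec[of v j] that verts(2) deg by fastforce
  qed

  \<comment> \<open>Small gates and the charging of paths to wires\<close>
  define cols where "cols v = (\<lambda>j. j mod dim_col A) ` {j. j < n \<and> F v j > 0}" for v
  \<comment> \<open>Non-vertices, where \<open>F\<close> is unconstrained, count as small.\<close>
  define S where "S = {v. v \<in> pverts G \<longrightarrow> card (cols v) \<le> t}"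
  have fin_cols: "finite (cols v)" for v unfolding cols_def by simp
  have cols_mono: "cols u \<subseteq> cols v" if "(u, v) \<in> R" for u v
    unfolding cols_def using F_pos[OF that] by blast
  have closed: "u \<in> S" if "(u, v) \<in> R" "v \<in> S" for u v
    using card_mono[OF fin_cols cols_mono[OF that(1)]] that verts[OF that(1)] by (simp add: S_def)
  \<comment> \<open>An input gate sees a single column and is small because
    \<open>t \<ge> 1\<close>. So the gates outside \<open>S\<close> are summing gates.\<close>
  have big: "v \<in> pverts G \<and> in_degree G v \<noteq> 0" if "v \<notin> S" for v
  proof -
    have "card (cols (inp k)) \<le> t" if "k < n" for k
    proof -
      have "F (inp k) j = of_bool (j = k)" if "j < n" for j
        using forms \<open>k < n\<close> that unfolding gate_forms_def by simp
      hence "cols (inp k) \<subseteq> {k mod dim_col A}"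
        unfolding cols_def by auto
      hence "card (cols (inp k)) \<le> card {k mod dim_col A}" by (intro card_mono) simp_all
      thus ?thesis using assms(5) by simp
    qed
    hence "v \<notin> inp ` {..<n}" using that by (auto simp: S_def)
    hence "v \<notin> {v \<in> pverts G. in_degree G v = 0}"
      using bij_betw_imp_surj_on[OF inputs] by simp
    thus ?thesis using that by (simp add: S_def)
  qed
  \<comment> \<open>\<open>weight e i * F (fst e) j\<close> counts the paths from \<open>x\<^sub>j\<close> to output \<open>i\<close> that are charged to \<open>e\<close>.\<close>
  define weight where "weight e i =
      (case outp i of None \<Rightarrow> 0 | Some z \<Rightarrow>
         if snd e \<in> S then of_bool (snd e = z)
         else if fst e \<in> S then num_paths R (snd e) z else 0)" for e i
  \<comment> \<open>The entries charged to \<open>e\<close> project onto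
    \<open>rows e \<times> cols (fst e)\<close>.\<close>
  define rows where "rows e = (\<lambda>i. i mod dim_row A) ` {i. i < m \<and> weight e i > 0}" for e

  \<comment> \<open>Every entry as a sum over wires\<close>
  have M_sum: "(B \<otimes>\<^sub>K A) $$ (i, j) = (\<Sum>e\<in>R. weight e i * F (fst e) j)"
    if ij: "i < m" "j < n" for i j
  proof (cases "outp i")
    case None
    thus ?thesis using M[OF ij] by (simp add: weight_def)
  next
    case (Some z)
    have z: "z \<in> pverts G" "in_degree G z \<noteq> 0" using outputs[OF ij(1) Some] by auto
    have "F z j = (\<Sum>e\<in>R. weight e i * F (fst e) j)"
    proof (cases "z \<in> S")
      case True
      \<comment> \<open>Wires leaving \<open>S\<close> never lead back to the small gate
        \<open>z\<close>, so only the wires into \<open>z\<close> itself have positive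
        weight.\<close>
      have "(\<Sum>e\<in>R. weight e i * F (fst e) j)
          = (\<Sum>e\<in>(\<lambda>u. (u, z)) ` {u. (u, z) \<in> R}. weight e i * F (fst e) j)"
        using finR True num_paths_into_closed[OF wfR closed _ True]
        by (intro sum.mono_neutral_right) (auto simp: weight_def Some)
      also have "\<dots> = (\<Sum>u | (u, z) \<in> R. F u j)"
        using True by (subst sum.reindex) (auto simp: inj_on_def weight_def Some)
      finally show ?thesis using F_rec[OF z ij(2)] by simp
    next
      case False
      have "F z j = (\<Sum>(u, w) | (u, w) \<in> R \<and> u \<in> S \<and> w \<notin> S. F u j * num_paths R w z)"
        by (rule cut_decomposition[OF finR wfR closed _ False, where f = "\<lambda>v. F v j"])
          (use big F_rec ij(2) in blast)+
      also have "\<dots> = (\<Sum>e | (fst e, snd e) \<in> R \<and> fst e \<in> S \<and> snd e \<notin> S. weight e i * F (fst e) j)"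
        by (intro sum.cong) (auto simp: weight_def Some)
      \<comment> \<open>The wires outside the cut have weight 0: a head in \<open>S\<close> differs
        from \<open>z\<close>, and both ends outside \<open>S\<close> give 0 by definition.\<close>
      also have "\<dots> = (\<Sum>e\<in>R. weight e i * F (fst e) j)"
        using finR False by (intro sum.mono_neutral_left) (auto simp: weight_def Some)
      finally show ?thesis .
    qed
    thus ?thesis using M[OF ij] by (simp add: Some)
  qed

  \<comment> \<open>Wires over a fixed 1-entry of \<open>A\<close>\<close>
  have rank: "nonneg_rank B \<le> card {e \<in> R. x \<in> rows e \<and> y \<in> cols (fst e)}"
    if xy: "x < dim_row A" "y < dim_col A" "A $$ (x, y) = 1" for x y
  proof (rule nonneg_rank_le_card)
    let ?p = "\<lambda>e a. weight e (a * dim_row A + x)"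
    let ?q = "\<lambda>e b. F (fst e) (b * dim_col A + y)"
    show "finite {e \<in> R. x \<in> rows e \<and> y \<in> cols (fst e)}" using finR by simp
    fix a b assume ab: "a < dim_row B" "b < dim_col B"
    have i: "a * dim_row A + x < m" and j: "b * dim_col A + y < n"
      using ab xy by (simp_all add: m_def n_def block_index_less)
    have "x \<in> rows e \<and> y \<in> cols (fst e)" if "?p e a * ?q e b \<noteq> 0" for e
    proof
      have "?p e a > 0" "?q e b > 0" using that by simp_all
      with i j have "a * dim_row A + x \<in> {i. i < m \<and> weight e i > 0}"
        "b * dim_col A + y \<in> {j. j < n \<and> F (fst e) j > 0}" by simp_all
      from imageI[OF this(1), of "\<lambda>i. i mod dim_row A"] imageI[OF this(2), of "\<lambda>j. j mod dim_col A"]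
      show "x \<in> rows e" "y \<in> cols (fst e)" unfolding rows_def cols_def using xy by simp_all
    qed
    hence "(\<Sum>e\<in>R. ?p e a * ?q e b) = (\<Sum>e | e \<in> R \<and> x \<in> rows e \<and> y \<in> cols (fst e). ?p e a * ?q e b)"
      using finR by (intro sum.mono_neutral_right) auto
    thus "B $$ (a, b) = (\<Sum>e | e \<in> R \<and> x \<in> rows e \<and> y \<in> cols (fst e). ?p e a * ?q e b)"
      using M_sum[OF i j] kronecker_block[OF ab xy(1,2)] xy(3) by simp
  qed

  \<comment> \<open>Size of a projected rectangle\<close>
  have rect: "card (rows e) * card (cols (fst e)) \<le> s * t" if "e \<in> R" for e
  proof -
    obtain u v where e: "e = (u, v)" by fastforce
    have uv: "(u, v) \<in> R" using that e by simp
    consider "u \<in> S" "v \<in> S" | "u \<in> S" "v \<notin> S" | "u \<notin> S" "v \<notin> S" using closed[OF uv] by blast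
    thus ?thesis
    proof cases
      case 1
      \<comment> \<open>Positive weight makes \<open>v\<close> the gate of output \<open>i\<close>.
        Distinct outputs have distinct gates, so at most one row remains, and
        \<open>s \<ge> 1\<close>.\<close>
      have "i = i'" if "i < m" "weight e i > 0" "i' < m" "weight e i' > 0" for i i'
        using that 1 outputs_distinct[of i i' v] by (auto simp: weight_def e split: option.splits)
      hence "card {i. i < m \<and> weight e i > 0} \<le> 1"
        by (simp add: card_le_Suc0_iff_eq)
      hence "card (rows e) \<le> 1" unfolding rows_def
        using card_image_le[of "{i. i < m \<and> weight e i > 0}" "\<lambda>i. i mod dim_row A"] by simp
      hence "card (rows e) \<le> s" using assms(4) by simp
      moreover have "card (cols u) \<le> t" using 1 verts[OF uv] by (simp add: S_def)
      ultimately show ?thesis unfolding e by (simp add: mult_le_mono)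
    next
      case 2
      \<comment> \<open>Freeness is applied to the columns of the head \<open>v\<close>, more than
        \<open>t\<close> in number; the rectangle itself has only the columns of the tail
        \<open>u\<close>, at most \<open>t\<close>.\<close>
      have "card (rows e) \<le> s"
      proof (rule free_mat_card[OF assms(3)])
        show "rows e \<subseteq> {..<dim_row A}" "cols v \<subseteq> {..<dim_col A}"
          unfolding rows_def cols_def m_def n_def by (auto intro: mod_less_of_less_mult)
        show "card (cols v) > t" using 2(2) by (simp add: S_def)
        fix x y assume "x \<in> rows e" "y \<in> cols v"
        then obtain i j where ij: "i < m" "j < n" "weight e i > 0" "F v j > 0"
          and xy: "x = i mod dim_row A" "y = j mod dim_col A"
          unfolding rows_def cols_def by auto
        from ij(3) obtain z where z: "outp i = Some z" "num_paths R v z > 0"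
          using 2 by (auto simp: weight_def e split: option.splits)
        \<comment> \<open>A path from \<open>v\<close> carries the variable \<open>j\<close> to the
          output gate \<open>z\<close>.\<close>
        from wfR z(2) have "F z j > 0"
          by (induction rule: num_paths_induct) (use ij F_pos in auto)
        hence "(B \<otimes>\<^sub>K A) $$ (i, j) > 0" using M[OF ij(1,2)] z(1) by simp
        thus "A $$ (x, y) = 1"
          using kronecker_pos_imp_one[OF assms(2)] ij(1,2) unfolding xy m_def n_def by blast
      qed
      moreover have "card (cols u) \<le> t" using 2 verts[OF uv] by (simp add: S_def)
      ultimately show ?thesis unfolding e by (simp add: mult_le_mono)
    next
      case 3
      hence "rows e = {}" by (auto simp: rows_def weight_def e split: option.splits)
      thus ?thesis by simp
    qed
  qed

  \<comment> \<open>Double counting of 1-entries of \<open>A\<close> against wires\<close>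
  define Ones where "Ones = {(i, j). i < dim_row A \<and> j < dim_col A \<and> A $$ (i, j) = 1}"
  have "Ones \<subseteq> {..<dim_row A} \<times> {..<dim_col A}" unfolding Ones_def by auto
  hence finO: "finite Ones" by (rule finite_subset) simp
  have "nonneg_rank B * num_ones A = (\<Sum>a\<in>Ones. nonneg_rank B)"
    by (simp add: num_ones_def Ones_def)
  also have "\<dots> \<le> (\<Sum>a\<in>Ones. card {e \<in> R. a \<in> rows e \<times> cols (fst e)})"
    by (intro sum_mono) (use rank in \<open>auto simp: Ones_def\<close>)
  also have "\<dots> = (\<Sum>e\<in>R. card {a \<in> Ones. a \<in> rows e \<times> cols (fst e)})"
    using finO finR by (rule sum_multicount_gen) simp
  also have "\<dots> \<le> (\<Sum>e\<in>R. card (rows e \<times> cols (fst e)))"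
    by (intro sum_mono card_mono) (auto simp: rows_def fin_cols)
  also have "\<dots> \<le> (\<Sum>e\<in>R. s * t)"
    by (intro sum_mono) (use rect in \<open>simp add: card_cartesian_product\<close>)
  finally show ?thesis by (simp add: R_def)
qed

theorem theorem11:
  fixes A B :: "nat mat" and n s t :: nat
  assumes "A \<in> carrier_mat n n" and "B \<in> carrier_mat n n"
    and "boolean_mat A" and "boolean_mat B"
    and "s \<ge> 1" and "t \<ge> 1"
    and "free_mat s t A"
  shows "real (sum_complexity (B \<otimes>\<^sub>K A))
           \<ge> real (nonneg_rank B) * (real (num_ones A) / (real s * real t))"
proof -
  \<comment> \<open>\<open>B \<otimes>\<^sub>K A\<close> is boolean, so some circuit computes it and
    the minimum is attained; the bound is applied to a minimal circuit.\<close>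
  have "\<exists>w (G :: nat pair_pre_digraph) inp outp. computes G inp outp (B \<otimes>\<^sub>K A) \<and> w = card (parcs G)"
    using computes_witness[OF boolean_mat_kronecker[OF assms(3,4)]] by blast
  from LeastI_ex[OF this] obtain G :: "nat pair_pre_digraph" and inp outp
    where G: "computes G inp outp (B \<otimes>\<^sub>K A)" "sum_complexity (B \<otimes>\<^sub>K A) = card (parcs G)"
    unfolding sum_complexity_def by blast
  have "nonneg_rank B * num_ones A \<le> sum_complexity (B \<otimes>\<^sub>K A) * (s * t)"
    using wires_lower_bound[OF G(1) assms(3,7,5,6)] G(2) by simp
  hence "real (nonneg_rank B) * real (num_ones A) \<le> real (sum_complexity (B \<otimes>\<^sub>K A)) * (real s * real t)"
    by (metis of_nat_le_iff of_nat_mult)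
  thus ?thesis using assms(5,6) by (simp add: divide_le_eq)
qed

end
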